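(* Let $\mathcal{X}:=\{2^{2^k}:k\in\mathbb{N}\}$, $\rho(x,y):=|x-y|$ for $x,y\in\mathcal{X}$, and let $\mu$ be the measure on $\mathcal{X}$ (defined on all subsets) with $\mu(\{2^{2^k}\})=2^k$ for any $k\in\mathbb{N}$. Then there exists a function $f\in L^2(\mathcal{X})\cap\bigcup_{s\in(0,1)}\dot{W}^{s,1}_{L^2}(\mathcal{X})$ such that $\|f\|_{L^2(\mathcal{X})}\in(0,\infty)$ and $$\lim_{s\to0^+}s^2\int_{\mathcal{X}}\left\{\int_{\mathcal{X}}\frac{|f(x)-f(y)|}{U(x,y)[\rho(x,y)]^s}\,d\mu(y)\right\}^2d\mu(x)=0.$$ Consequently, there do not exist positive constants $C,\widetilde C$ such that, for all $f\in[L^2(\mathcal{X})/\mathbb{R}]\cap\bigcup_{s\in(0,1)}\dot{W}^{s,1}_{L^2}(\mathcal{X})$, $$C\|f\|_{L^2(\mathcal{X})/\mathbb{R}}\le\liminf_{s\to0^+}s\left\|\int_{\mathcal{X}}\frac{|f(\cdot)-f(y)|}{U(\cdot,y)[\rho(\cdot,y)]^{s}}\,d\mu(y)\right\|_{L^2(\mathcal{X})}\le\limsup_{s\to0^+}s\left\|\int_{\mathcal{X}}\frac{|f(\cdot)-f(y)|}{U(\cdot,y)[\rho(\cdot,y)]^{s}}\,d\mu(y)\right\|_{L^2(\mathcal{X})}\le\widetilde C\|f\|_{L^2(\mathcal{X})/\mathbb{R}}.$$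
   Context: $\mathbb{N}=\{1,2,\dots\}$. $B(x,r):=\{y\in\mathcal{X}:\rho(x,y)<r\}$ and $U(x,y):=\min\{\mu(B(x,\rho(x,y))),\mu(B(y,\rho(x,y)))\}$; the integrand $|f(x)-f(y)|/(U(x,y)[\rho(x,y)]^s)$ is read as $0$ at $y=x$. $\dot W^{s,1}_{L^2}(\mathcal{X})$ is the set of functions $f$ on $\mathcal{X}$ with $\big\|\int_{\mathcal{X}}\frac{|f(\cdot)-f(y)|}{U(\cdot,y)[\rho(\cdot,y)]^s}d\mu(y)\big\|_{L^2(\mathcal{X})}<\infty$. $L^2(\mathcal{X})/\mathbb{R}$ is the set of functions $f$ (modulo additive real constants) with $\|f\|_{L^2(\mathcal{X})/\mathbb{R}}:=\inf_{a\in\mathbb{R}}\|f+a\|_{L^2(\mathcal{X})}<\infty$. $s\to0^+$ means $s\in(0,1)$, $s\to0$. *)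

theory Defs
  imports "HOL-Analysis.Analysis"
begin

text \<open>
  A metric measure space is given by a measure \<open>M\<close>, whose \<open>space\<close> is the underlying set, and a
  distance \<open>\<rho>\<close>. Functions on it are real-valued and matter only on \<open>space M\<close>. Measures of balls,
  integrals of nonnegative functions and norms are all taken in \<open>ennreal\<close>, so that they make
  sense (with value \<open>\<infinity>\<close>) also when they diverge.
\<close>

definition mm_ball :: "'a measure \<Rightarrow> ('a \<Rightarrow> 'a \<Rightarrow> real) \<Rightarrow> 'a \<Rightarrow> real \<Rightarrow> 'a set" where
  "mm_ball M \<rho> x r = {y \<in> space M. \<rho> x y < r}"

definition mm_U :: "'a measure \<Rightarrow> ('a \<Rightarrow> 'a \<Rightarrow> real) \<Rightarrow> 'a \<Rightarrow> 'a \<Rightarrow> ennreal" where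
  "mm_U M \<rho> x y = min (emeasure M (mm_ball M \<rho> x (\<rho> x y))) (emeasure M (mm_ball M \<rho> y (\<rho> x y)))"

definition frac_integral ::
  "'a measure \<Rightarrow> ('a \<Rightarrow> 'a \<Rightarrow> real) \<Rightarrow> real \<Rightarrow> ('a \<Rightarrow> real) \<Rightarrow> 'a \<Rightarrow> ennreal" where
  "frac_integral M \<rho> s f x =
     (\<integral>\<^sup>+y. (if y = x then 0
            else ennreal \<bar>f x - f y\<bar> / (mm_U M \<rho> x y * ennreal (\<rho> x y powr s))) \<partial>M)"

definition ennreal_sqrt :: "ennreal \<Rightarrow> ennreal" where
  "ennreal_sqrt a = (if a = \<infinity> then \<infinity> else ennreal (sqrt (enn2real a)))"

definition L2_norm :: "'a measure \<Rightarrow> ('a \<Rightarrow> ennreal) \<Rightarrow> ennreal" where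
  "L2_norm M g = ennreal_sqrt (\<integral>\<^sup>+x. (g x)\<^sup>2 \<partial>M)"

definition L2_space :: "'a measure \<Rightarrow> ('a \<Rightarrow> real) set" where
  "L2_space M = {f \<in> borel_measurable M. L2_norm M (\<lambda>x. ennreal \<bar>f x\<bar>) < \<infinity>}"

definition L2_mod_const_norm :: "'a measure \<Rightarrow> ('a \<Rightarrow> real) \<Rightarrow> ennreal" where
  "L2_mod_const_norm M f = (INF a::real. L2_norm M (\<lambda>x. ennreal \<bar>f x + a\<bar>))"

text \<open>
  Elements of \<open>L\<^sup>2/\<real>\<close> are represented by functions: the quotient norm and the fractional integrals
  do not change when a real constant is added to the function.
\<close>
definition L2_mod_const :: "'a measure \<Rightarrow> ('a \<Rightarrow> real) set" where
  "L2_mod_const M = {f \<in> borel_measurable M. L2_mod_const_norm M f < \<infinity>}"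

definition frac_Sobolev :: "'a measure \<Rightarrow> ('a \<Rightarrow> 'a \<Rightarrow> real) \<Rightarrow> real \<Rightarrow> ('a \<Rightarrow> real) set" where
  "frac_Sobolev M \<rho> s = {f \<in> borel_measurable M. L2_norm M (frac_integral M \<rho> s f) < \<infinity>}"

definition XX :: "real set" where
  "XX = {2 ^ (2 ^ k) | k::nat. k \<ge> 1}"

definition rhoX :: "real \<Rightarrow> real \<Rightarrow> real" where
  "rhoX x y = \<bar>x - y\<bar>"

text \<open>
  The push-forward under \<open>k \<mapsto> 2 ^ (2 ^ k)\<close> of the measure with weights \<open>2 ^ k\<close> on
  \<open>{1, 2, \<dots>}\<close>; the three lemmas characterize it.
\<close>
definition muX :: "real measure" where
  "muX = distr (density (count_space {1::nat..}) (\<lambda>k. 2 ^ k)) (count_space XX) (\<lambda>k. 2 ^ (2 ^ k))"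

lemma space_muX: "space muX = XX"
  by (simp add: muX_def)

lemma sets_muX: "sets muX = Pow XX"
  by (simp add: muX_def)

lemma emeasure_muX:
  fixes k :: nat
  assumes "k \<ge> 1"
  shows "emeasure muX {2 ^ (2 ^ k)} = 2 ^ k"
proof -
  have eq: "(2::real) ^ (2 ^ j) = 2 ^ (2 ^ k) \<longleftrightarrow> j = k" for j :: nat
    by simp
  have m: "(\<lambda>k::nat. (2::real) ^ (2 ^ k))
      \<in> measurable (density (count_space {1..}) (\<lambda>k. 2 ^ k)) (count_space XX)"
    by (auto simp: measurable_def XX_def)
  have pre: "(\<lambda>k::nat. (2::real) ^ (2 ^ k)) -` {2 ^ (2 ^ k)} \<inter> {1..} = {k}"
    using assms eq by auto
  have "emeasure muX {2 ^ (2 ^ k)} = emeasure (density (count_space {1::nat..}) (\<lambda>k. 2 ^ k)) {k}"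
    unfolding muX_def using assms pre by (subst emeasure_distr[OF m]) (auto simp: XX_def)
  also have "\<dots> = (\<integral>\<^sup>+j. 2 ^ j * indicator {k} j \<partial>count_space {1::nat..})"
    using assms by (subst emeasure_density) auto
  also have "\<dots> = 2 ^ k * emeasure (count_space {1::nat..}) {k}"
    using assms by (intro nn_integral_indicator_singleton) auto
  also have "\<dots> = 2 ^ k"
    using assms by simp
  finally show ?thesis .
qed

end

theory Submission
  imports Defs
begin

text \<open>
  The witness is the indicator function \<open>f\<close> of the smallest point \<open>4\<close> of the space. Write
  \<open>x\<^sub>k = 2 ^ (2 ^ k)\<close>. For \<open>k \<ge> 1\<close> the balls that define \<open>U(x\<^bsub>k+1\<^esub>, 4)\<close> contain \<open>x\<^sub>k\<close> and \<open>x\<^bsub>k+1\<^esub>\<close>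
  respectively, so \<open>U(x\<^bsub>k+1\<^esub>, 4) \<ge> 2 ^ k\<close>, while \<open>\<rho>(x\<^bsub>k+1\<^esub>, 4) \<ge> x\<^sub>k\<close>. The mass \<open>2 ^ (k + 1)\<close> of
  \<open>x\<^bsub>k+1\<^esub>\<close> therefore cancels against \<open>U\<close>, and the fractional integral of \<open>f\<close> at \<open>4\<close> is at most
  \<open>2 * (\<Sum>k. 2 powr (- s * 2 ^ k))\<close>, over \<open>k \<ge> 1\<close>. The distances grow doubly exponentially, so only
  about \<open>ln (1 / s)\<close> terms of this sum are not negligible: it is much smaller than \<open>1 / s\<close>, the
  size at which the limit would become positive. The crude bound \<open>2 powr u \<ge> sqrt (2 * u)\<close> already
  turns the sum into a geometric series of size \<open>O(s powr (-1/2))\<close>.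

  At the other points \<open>x\<^bsub>k+1\<^esub>\<close> only \<open>y = 4\<close> contributes, with a value at most \<open>2 * (1/2) ^ k\<close>;
  the squares of these values, weighted by \<open>2 ^ (k + 1)\<close>, have a bounded sum. Altogether the square
  of the \<open>L\<^sup>2\<close> norm of the fractional integral is at most \<open>136 / s\<close>
  (\<open>frac_integral_bump_L2_bound\<close>), which tends to \<open>0\<close> after multiplication by \<open>s\<^sup>2\<close>.

  For the consequence, \<open>s\<close> times the norm is at most \<open>sqrt (136 * s)\<close>, so the lower limit in the
  claimed equivalence vanishes. But \<open>f\<close> is not constant on the two points \<open>4\<close> and \<open>16\<close>, so its
  norm modulo constants is positive (\<open>L2_mod_const_norm_bump_ge_1\<close>), which contradicts the lower
  estimate with any \<open>C > 0\<close>.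
\<close>

section \<open>Norms and series of extended nonnegative reals\<close>

lemma ennreal_sqrt_ennreal: "0 \<le> b \<Longrightarrow> ennreal_sqrt (ennreal b) = ennreal (sqrt b)"
  by (simp add: ennreal_sqrt_def)

lemma ennreal_sqrt_mono: "a \<le> b \<Longrightarrow> ennreal_sqrt a \<le> ennreal_sqrt b"
  by (auto simp: ennreal_sqrt_def top_unique less_top intro!: ennreal_leI enn2real_mono)

lemma L2_norm_le:
  assumes "(\<integral>\<^sup>+x. (g x)\<^sup>2 \<partial>M) \<le> ennreal b" "0 \<le> b"
  shows "L2_norm M g \<le> ennreal (sqrt b)"
  using ennreal_sqrt_mono[OF assms(1)] assms(2) by (simp add: L2_norm_def ennreal_sqrt_ennreal)

lemma suminf_geometric_le:
  assumes "\<And>i. h i \<le> ennreal (c * q ^ i)" "0 \<le> c" "0 \<le> q" "q < 1"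
  shows "(\<Sum>i. h i) \<le> ennreal (c / (1 - q))"
proof -
  have s: "(\<lambda>i. c * q ^ i) sums (c / (1 - q))"
    using sums_mult[OF geometric_sums[of q], of c] assms by simp
  have "(\<Sum>i. h i) \<le> (\<Sum>i. ennreal (c * q ^ i))"
    by (intro suminf_le assms(1) summableI)
  also have "\<dots> = ennreal (c / (1 - q))"
    by (rule suminf_ennreal_eq[OF _ s]) (use assms in simp)
  finally show ?thesis .
qed

lemma suminf_ennreal_split_head: "(\<Sum>i. h i) = (\<Sum>i. h (Suc i)) + (h 0 :: ennreal)"
  using suminf_offset[of h 1] by (simp add: summableI)

section \<open>The space of doubly exponential points\<close>

definition node :: "nat \<Rightarrow> real" where
  "node k = 2 ^ (2 ^ k)"

lemma node_less_iff [simp]: "node j < node k \<longleftrightarrow> j < k"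
  by (simp add: node_def)

lemma node_eq_iff [simp]: "node j = node k \<longleftrightarrow> j = k"
  by (simp add: node_def)

lemma node_in_XX: "1 \<le> k \<Longrightarrow> node k \<in> XX"
  by (auto simp: XX_def node_def)

lemma node_1 [simp]: "node (Suc 0) = 4"
  by (simp add: node_def)

lemma node_ge_4: "1 \<le> k \<Longrightarrow> 4 \<le> node k"
  using node_less_iff[of k 1] node_1 by (metis not_less One_nat_def)

lemma node_Suc: "node (Suc k) = node k * node k"
  by (simp add: node_def power_add mult_2)

lemma nn_integral_muX: "(\<integral>\<^sup>+x. g x \<partial>muX) = (\<Sum>j. 2 ^ Suc j * g (node (Suc j)))"
proof -
  have m: "(\<lambda>k::nat. (2::real) ^ (2 ^ k))
      \<in> measurable (density (count_space {1..}) (\<lambda>k. 2 ^ k)) (count_space XX)"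
    by (auto simp: measurable_def XX_def)
  have b: "bij_betw Suc UNIV {1::nat..}"
    by (rule bij_betwI[where g = "\<lambda>n. n - 1"]) auto
  have "(\<integral>\<^sup>+x. g x \<partial>muX)
      = (\<integral>\<^sup>+k. g (node k) \<partial>density (count_space {1::nat..}) (\<lambda>k. 2 ^ k))"
    unfolding muX_def node_def by (subst nn_integral_distr[OF m]) auto
  also have "\<dots> = (\<integral>\<^sup>+k. 2 ^ k * g (node k) \<partial>count_space {1::nat..})"
    by (subst nn_integral_density) auto
  also have "\<dots> = (\<integral>\<^sup>+j. 2 ^ Suc j * g (node (Suc j)) \<partial>count_space UNIV)"
    by (rule nn_integral_bij_count_space[OF b, symmetric])
  also have "\<dots> = (\<Sum>j. 2 ^ Suc j * g (node (Suc j)))"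
    by (rule nn_integral_count_space_nat)
  finally show ?thesis .
qed

lemma rhoX_commute: "rhoX x y = rhoX y x"
  by (simp add: rhoX_def abs_minus_commute)

lemma mm_U_rhoX_commute: "mm_U M rhoX x y = mm_U M rhoX y x"
  by (simp add: mm_U_def rhoX_commute[of x y] min.commute)

lemma emeasure_muX_ge:
  assumes "node k \<in> A" "1 \<le> k" "A \<subseteq> XX"
  shows "2 ^ k \<le> emeasure muX A"
proof -
  have "2 ^ k = emeasure muX {node k}"
    using emeasure_muX[OF assms(2)] by (simp add: node_def)
  also have "\<dots> \<le> emeasure muX A"
    using assms by (intro emeasure_mono) (auto simp: sets_muX)
  finally show ?thesis .
qed

text \<open>
  The ball around \<open>4\<close> contains the predecessor \<open>node k\<close> of \<open>node (Suc k)\<close>, and the ball around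
  \<open>node (Suc k)\<close> contains its own centre.
\<close>
lemma mm_U_node_4_ge:
  assumes "1 \<le> k"
  shows "2 ^ k \<le> mm_U muX rhoX (node (Suc k)) 4"
proof -
  have k: "4 \<le> node k" "node k < node (Suc k)"
    using node_ge_4[OF assms] by auto
  have "2 ^ k \<le> emeasure muX (mm_ball muX rhoX 4 (rhoX (node (Suc k)) 4))"
    using assms k by (intro emeasure_muX_ge)
      (auto simp: mm_ball_def space_muX node_in_XX rhoX_def simp del: node_less_iff)
  moreover have "2 ^ k \<le> emeasure muX (mm_ball muX rhoX (node (Suc k)) (rhoX (node (Suc k)) 4))"
  proof -
    have "(2::ennreal) ^ k \<le> 2 ^ Suc k"
      by (rule power_increasing) auto
    also have "\<dots> \<le> emeasure muX (mm_ball muX rhoX (node (Suc k)) (rhoX (node (Suc k)) 4))"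
      using assms k by (intro emeasure_muX_ge)
        (auto simp: mm_ball_def space_muX node_in_XX rhoX_def simp del: node_less_iff)
    finally show ?thesis .
  qed
  ultimately show ?thesis
    by (simp add: mm_U_def)
qed

lemma node_le_rhoX_4:
  assumes "1 \<le> k"
  shows "node k \<le> rhoX (node (Suc k)) 4"
proof -
  have "4 * node k \<le> node k * node k"
    using node_ge_4[OF assms] by (intro mult_right_mono) auto
  then have "node k \<le> node k * node k - 4"
    using node_ge_4[OF assms] by linarith
  then show ?thesis
    by (simp add: rhoX_def node_Suc)
qed

lemma kernel_node_4_le:
  assumes "1 \<le> k" "0 \<le> s"
  shows "1 / (mm_U muX rhoX (node (Suc k)) 4 * ennreal (rhoX (node (Suc k)) 4 powr s))
           \<le> ennreal (1 / (2 ^ k * node k powr s))"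
proof -
  have pos: "0 < node k"
    using node_ge_4[OF assms(1)] by simp
  define v where "v = 2 ^ k * node k powr s"
  have v: "0 < v"
    using pos by (simp add: v_def)
  have "ennreal v = 2 ^ k * ennreal (node k powr s)"
    by (simp add: v_def ennreal_mult flip: ennreal_power)
  also have "\<dots> \<le> mm_U muX rhoX (node (Suc k)) 4 * ennreal (rhoX (node (Suc k)) 4 powr s)"
    (is "_ \<le> ?D")
    using assms pos
    by (intro mult_mono mm_U_node_4_ge ennreal_leI powr_mono2 node_le_rhoX_4) auto
  finally have D: "ennreal v \<le> ?D" .
  have "1 = ennreal v * ennreal (1 / v)"
    using v by (simp flip: ennreal_mult)
  also have "\<dots> \<le> ?D * ennreal (1 / v)"
    using D by (intro mult_right_mono) auto
  finally have "1 / ?D \<le> ennreal (1 / v)"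
    using D v by (intro divide_le_posI_ennreal) (auto intro: less_le_trans[OF _ D])
  then show ?thesis
    by (simp add: v_def)
qed

section \<open>The indicator of the smallest point\<close>

definition bump :: "real \<Rightarrow> real" where
  "bump x = (if x = 4 then 1 else 0)"

lemma node_Suc_neq_4 [simp]: "node (Suc (Suc i)) \<noteq> 4"
  using node_eq_iff[of "Suc (Suc i)" 1] by (simp del: node_eq_iff)

lemma bump_measurable: "bump \<in> borel_measurable muX"
  by (auto simp: measurable_def sets_muX space_muX)

text \<open>
  The elementary bound behind the \<open>O(s powr (-1/2))\<close> estimate: with \<open>u = s * 2 ^ (i + 1)\<close>,
  \<open>2 powr u \<ge> 1 + u / 2 \<ge> sqrt (2 * u)\<close>.
\<close>
lemma node_powr_ge:
  assumes "0 \<le> s"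
  shows "sqrt s * sqrt 2 ^ i \<le> node (Suc i) powr s"
proof -
  define u where "u = s * 2 ^ Suc i"
  have u: "0 \<le> u"
    using assms by (simp add: u_def)
  have "sqrt s * sqrt 2 ^ i = sqrt (s * 2 ^ i)"
    by (simp add: real_sqrt_mult real_sqrt_power)
  also have "\<dots> \<le> sqrt ((1 + u / 2)\<^sup>2)"
    using assms u by (intro real_sqrt_le_mono) (simp add: u_def power2_eq_square algebra_simps)
  also have "\<dots> = 1 + u / 2"
    using u by simp
  also have "\<dots> \<le> 1 + u * ln 2"
    using mult_left_mono[of "1/2" "ln 2" u] ln2_ge_two_thirds u by simp
  also have "\<dots> \<le> exp (u * ln 2)"
    by (rule exp_ge_add_one_self)
  also have "\<dots> = node (Suc i) powr s"
    by (simp add: node_def powr_def ln_realpow u_def mult_ac)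
  finally show ?thesis .
qed

text \<open>
  The weight \<open>2 ^ (k + 1)\<close> of \<open>node (k + 1)\<close> divided by the lower bound \<open>2 ^ k\<close> for \<open>U\<close> leaves the
  factor \<open>2\<close>, so only the decay of \<open>node k powr (-s)\<close> makes the series converge, and
  \<open>node_powr_ge\<close> compares it with a geometric series of ratio \<open>1 / sqrt 2\<close>.
\<close>
lemma frac_integral_bump_at_4:
  assumes "0 < s"
  shows "frac_integral muX rhoX s bump 4 \<le> ennreal (8 / sqrt s)"
proof -
  let ?K = "\<lambda>y. if y = 4 then 0
     else ennreal \<bar>bump 4 - bump y\<bar> / (mm_U muX rhoX 4 y * ennreal (rhoX 4 y powr s))"
  have term_le: "2 ^ Suc (Suc i) * ?K (node (Suc (Suc i))) \<le> ennreal (2 / sqrt s * (1 / sqrt 2) ^ i)"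
    for i
  proof -
    let ?k = "Suc i"
    have "?K (node (Suc ?k)) \<le> ennreal (1 / (2 ^ ?k * node ?k powr s))"
      using kernel_node_4_le[of ?k s] assms
      by (simp add: bump_def mm_U_rhoX_commute[of _ 4] rhoX_commute[of 4])
    then have "2 ^ Suc ?k * ?K (node (Suc ?k))
        \<le> ennreal (2 ^ Suc ?k) * ennreal (1 / (2 ^ ?k * node ?k powr s))"
      by (intro mult_mono) (auto simp: ennreal_mult simp flip: ennreal_power)
    also have "\<dots> = ennreal (2 / node ?k powr s)"
      by (subst ennreal_mult[symmetric]) auto
    also have "\<dots> \<le> ennreal (2 / (sqrt s * sqrt 2 ^ i))"
      using node_powr_ge[of s i] assms by (intro ennreal_leI divide_left_mono) (auto simp: node_def)
    also have "2 / (sqrt s * sqrt 2 ^ i) = 2 / sqrt s * (1 / sqrt 2) ^ i"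
      by (simp add: power_one_over)
    finally show ?thesis .
  qed
  \<comment> \<open>This keeps the sum of the geometric series below four times its first term.\<close>
  have r: "1 / sqrt 2 \<le> (3 / 4 :: real)"
    using real_le_rsqrt[of "4/3" 2] by (simp add: field_simps power2_eq_square)
  have "frac_integral muX rhoX s bump 4
      = (\<Sum>i. 2 ^ Suc (Suc i) * ?K (node (Suc (Suc i))))"
    unfolding frac_integral_def nn_integral_muX
    by (subst suminf_ennreal_split_head) simp
  also have "\<dots> \<le> ennreal (2 / sqrt s / (1 - 1 / sqrt 2))"
    by (rule suminf_geometric_le[OF term_le]) (use assms in auto)
  also have "\<dots> \<le> ennreal (2 / sqrt s / (1 / 4))"
    using assms r by (intro ennreal_leI divide_left_mono) auto
  finally show ?thesis
    by simp
qed

text \<open>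
  Away from \<open>4\<close> the integrand is nonzero at \<open>y = 4\<close> only, and already the growth of \<open>U\<close> gives a
  bound uniform in \<open>s\<close>: the distances are at least \<open>1\<close>, so their powers can be dropped.
\<close>
lemma frac_integral_bump_off_4:
  assumes "0 \<le> s"
  shows "frac_integral muX rhoX s bump (node (Suc (Suc i))) \<le> ennreal ((1 / 2) ^ i)"
proof -
  let ?x = "node (Suc (Suc i))"
  let ?K = "\<lambda>y. if y = ?x then 0
     else ennreal \<bar>bump ?x - bump y\<bar> / (mm_U muX rhoX ?x y * ennreal (rhoX ?x y powr s))"
  have K: "?K (node (Suc (Suc j))) = 0" for j
    by (simp add: bump_def)
  have "frac_integral muX rhoX s bump ?x
      = (\<Sum>j. 2 ^ Suc (Suc j) * ?K (node (Suc (Suc j)))) + 2 * ?K 4"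
    unfolding frac_integral_def nn_integral_muX by (subst suminf_ennreal_split_head) simp
  also have "\<dots> = 2 * (1 / (mm_U muX rhoX ?x 4 * ennreal (rhoX ?x 4 powr s)))"
    unfolding K by (simp add: bump_def node_Suc_neq_4[symmetric])
  also have "\<dots> \<le> 2 * ennreal (1 / (2 ^ Suc i * node (Suc i) powr s))"
    using assms by (intro mult_left_mono kernel_node_4_le) auto
  also have "\<dots> \<le> 2 * ennreal (1 / (2 ^ Suc i * 1))"
    using assms node_ge_4[of "Suc i"]
    by (intro mult_left_mono ennreal_leI divide_left_mono mult_left_mono ge_one_powr_ge_zero) auto
  also have "\<dots> = ennreal (2 * (1 / (2 ^ Suc i * 1)))"
    by (subst ennreal_mult) auto
  also have "2 * (1 / (2 ^ Suc i * 1)) = ((1 / 2) ^ i :: real)"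
    by (simp add: power_one_over)
  finally show ?thesis .
qed

text \<open>
  The point \<open>4\<close> has mass \<open>2\<close> and contributes at most \<open>2 * (8 / sqrt s)\<^sup>2 = 128 / s\<close>; the other
  points contribute at most \<open>8\<close>, which is at most \<open>8 / s\<close>.
\<close>
lemma frac_integral_bump_L2_bound:
  assumes "0 < s" "s < 1"
  shows "(\<integral>\<^sup>+x. (frac_integral muX rhoX s bump x)\<^sup>2 \<partial>muX) \<le> ennreal (136 / s)"
proof -
  let ?F = "frac_integral muX rhoX s bump"
  have tail: "2 ^ Suc (Suc i) * (?F (node (Suc (Suc i))))\<^sup>2 \<le> ennreal (4 * (1 / 2) ^ i)" for i
  proof -
    have "2 ^ Suc (Suc i) * (?F (node (Suc (Suc i))))\<^sup>2
        \<le> ennreal (2 ^ Suc (Suc i)) * (ennreal ((1 / 2) ^ i))\<^sup>2"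
      using assms by (intro mult_mono power_mono frac_integral_bump_off_4)
        (auto simp: ennreal_mult simp flip: ennreal_power)
    also have "\<dots> = ennreal (2 ^ Suc (Suc i) * ((1 / 2) ^ i)\<^sup>2)"
      by (simp add: ennreal_power ennreal_mult)
    also have "2 ^ Suc (Suc i) * ((1 / 2) ^ i)\<^sup>2 = 4 * (1 / 2 :: real) ^ i"
      by (simp add: power2_eq_square power_one_over)
    finally show ?thesis .
  qed
  have "(?F 4)\<^sup>2 \<le> (ennreal (8 / sqrt s))\<^sup>2"
    using assms by (intro power_mono frac_integral_bump_at_4) auto
  also have "\<dots> = ennreal (64 / s)"
    using assms by (simp add: ennreal_power power_divide)
  finally have head: "2 * (?F 4)\<^sup>2 \<le> 2 * ennreal (64 / s)"
    by (intro mult_left_mono) auto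
  have "(\<integral>\<^sup>+x. (?F x)\<^sup>2 \<partial>muX)
      = (\<Sum>i. 2 ^ Suc (Suc i) * (?F (node (Suc (Suc i))))\<^sup>2) + 2 * (?F 4)\<^sup>2"
    unfolding nn_integral_muX by (subst suminf_ennreal_split_head) simp
  also have "\<dots> \<le> ennreal (4 / (1 - 1 / 2)) + 2 * ennreal (64 / s)"
    by (intro add_mono head suminf_geometric_le[OF tail]) auto
  also have "\<dots> = ennreal (8 + 128 / s)"
    using assms ennreal_mult[of 2 "64 / s"] ennreal_plus[of 8 "128 / s"] by simp
  also have "\<dots> \<le> ennreal (136 / s)"
    using assms by (intro ennreal_leI) (simp add: field_simps)
  finally show ?thesis .
qed

lemma L2_norm_bump_finite: "L2_norm muX (\<lambda>x. ennreal \<bar>bump x\<bar>) < \<infinity>"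
proof -
  have "(\<integral>\<^sup>+x. (ennreal \<bar>bump x\<bar>)\<^sup>2 \<partial>muX) = 2"
    unfolding nn_integral_muX by (subst suminf_ennreal_split_head) (simp add: bump_def)
  then have "L2_norm muX (\<lambda>x. ennreal \<bar>bump x\<bar>) \<le> ennreal (sqrt 2)"
    by (intro L2_norm_le) auto
  then show ?thesis
    by (simp add: less_top top_unique) (metis ennreal_less_top order.strict_trans1)
qed

text \<open>
  The points \<open>4\<close> and \<open>16\<close>, of masses \<open>2\<close> and \<open>4\<close>, already contribute
  \<open>2 * (1 + a)\<^sup>2 + 4 * a\<^sup>2 \<ge> 4 / 3\<close> to the square of the norm of \<open>bump + a\<close>.
\<close>
lemma L2_norm_bump_plus_const_ge_1: "1 \<le> L2_norm muX (\<lambda>x. ennreal \<bar>bump x + a\<bar>)"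
proof -
  let ?t = "\<lambda>j. 2 ^ Suc j * (ennreal \<bar>bump (node (Suc j)) + a\<bar>)\<^sup>2"
  have "0 \<le> (3 * a + 1)\<^sup>2"
    by simp
  then have "1 \<le> 2 * (1 + a)\<^sup>2 + 4 * a\<^sup>2"
    unfolding power2_eq_square by (simp add: algebra_simps)
  then have "ennreal 1 \<le> ennreal (2 * (1 + a)\<^sup>2 + 4 * a\<^sup>2)"
    by (rule ennreal_leI)
  also have "\<dots> = (\<Sum>j<2. ?t j)"
    using node_Suc_neq_4[of 0, folded numeral_2_eq_2]
    by (simp add: lessThan_nat_numeral bump_def ennreal_power ennreal_mult
      flip: numeral_2_eq_2)
  also have "\<dots> \<le> (\<Sum>j. ?t j)"
    by (rule sum_le_suminf) (auto intro: summableI)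
  also have "\<dots> = (\<integral>\<^sup>+x. (ennreal \<bar>bump x + a\<bar>)\<^sup>2 \<partial>muX)"
    by (simp add: nn_integral_muX)
  finally show ?thesis
    using ennreal_sqrt_mono[of 1] ennreal_sqrt_ennreal[of 1] by (simp add: L2_norm_def)
qed

lemma L2_mod_const_norm_bump_ge_1: "1 \<le> L2_mod_const_norm muX bump"
  unfolding L2_mod_const_norm_def by (rule INF_greatest) (rule L2_norm_bump_plus_const_ge_1)

lemma bump_in_L2_mod_const: "bump \<in> L2_mod_const muX"
proof -
  have "L2_mod_const_norm muX bump \<le> L2_norm muX (\<lambda>x. ennreal \<bar>bump x + 0\<bar>)"
    unfolding L2_mod_const_norm_def by (rule INF_lower) simp
  also have "\<dots> < \<infinity>"
    using L2_norm_bump_finite by simp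
  finally show ?thesis
    by (simp add: L2_mod_const_def bump_measurable)
qed

lemma bump_in_frac_Sobolev:
  assumes "0 < s" "s < 1"
  shows "bump \<in> frac_Sobolev muX rhoX s"
proof -
  have "L2_norm muX (frac_integral muX rhoX s bump) \<le> ennreal (sqrt (136 / s))"
    using assms by (intro L2_norm_le frac_integral_bump_L2_bound) auto
  also have "\<dots> < \<infinity>"
    by simp
  finally show ?thesis
    by (simp add: frac_Sobolev_def bump_measurable)
qed

section \<open>The limit at order zero\<close>

lemma eventually_at_right_unit_interval: "\<forall>\<^sub>F s::real in at_right 0. 0 < s \<and> s < 1"
  using eventually_at_right_real[of 0 1] by (simp add: greaterThanLessThan_iff)

lemma frac_energy_bump_tendsto_0:
  "((\<lambda>s::real. ennreal (s\<^sup>2) * (\<integral>\<^sup>+x. (frac_integral muX rhoX s bump x)\<^sup>2 \<partial>muX))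
      \<longlongrightarrow> 0) (at_right 0)"
proof (rule tendsto_sandwich[of "\<lambda>_. 0" _ _ "\<lambda>s. ennreal (136 * s)"])
  show "\<forall>\<^sub>F s::real in at_right 0.
      ennreal (s\<^sup>2) * (\<integral>\<^sup>+x. (frac_integral muX rhoX s bump x)\<^sup>2 \<partial>muX) \<le> ennreal (136 * s)"
    using eventually_at_right_unit_interval
  proof eventually_elim
    case (elim s)
    then have "ennreal (s\<^sup>2) * (\<integral>\<^sup>+x. (frac_integral muX rhoX s bump x)\<^sup>2 \<partial>muX)
        \<le> ennreal (s\<^sup>2) * ennreal (136 / s)"
      by (intro mult_left_mono frac_integral_bump_L2_bound) auto
    also have "\<dots> = ennreal (136 * s)"
      using elim by (simp add: power2_eq_square flip: ennreal_mult)
    finally show ?case .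
  qed
  have "((\<lambda>s::real. ennreal (136 * s)) \<longlongrightarrow> ennreal (136 * 0)) (at_right 0)"
    by (intro tendsto_intros)
  then show "((\<lambda>s::real. ennreal (136 * s)) \<longlongrightarrow> 0) (at_right 0)"
    by simp
qed auto

lemma frac_norm_bump_tendsto_0:
  "((\<lambda>s::real. ennreal s * L2_norm muX (frac_integral muX rhoX s bump)) \<longlongrightarrow> 0) (at_right 0)"
proof (rule tendsto_sandwich[of "\<lambda>_. 0" _ _ "\<lambda>s. ennreal (sqrt (136 * s))"])
  show "\<forall>\<^sub>F s::real in at_right 0.
      ennreal s * L2_norm muX (frac_integral muX rhoX s bump) \<le> ennreal (sqrt (136 * s))"
    using eventually_at_right_unit_interval
  proof eventually_elim
    case (elim s)
    then have "ennreal s * L2_norm muX (frac_integral muX rhoX s bump)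
        \<le> ennreal s * ennreal (sqrt (136 / s))"
      by (intro mult_left_mono L2_norm_le frac_integral_bump_L2_bound) auto
    also have "\<dots> = ennreal (s * sqrt (136 / s))"
      using elim by (simp add: ennreal_mult)
    also have "s * sqrt (136 / s) = sqrt (s\<^sup>2 * (136 / s))"
      using elim by (simp only: real_sqrt_mult) simp
    also have "s\<^sup>2 * (136 / s) = 136 * s"
      using elim by (simp add: power2_eq_square)
    finally show ?case .
  qed
  have "((\<lambda>s::real. ennreal (sqrt (136 * s))) \<longlongrightarrow> ennreal (sqrt (136 * 0))) (at_right 0)"
    by (intro tendsto_intros)
  then show "((\<lambda>s::real. ennreal (sqrt (136 * s))) \<longlongrightarrow> 0) (at_right 0)"
    by simp
qed auto

theorem proposition2p34:
  shows "(\<exists>f \<in> L2_space muX \<inter> (\<Union>s\<in>{0<..<1}. frac_Sobolev muX rhoX s).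
            0 < L2_norm muX (\<lambda>x. ennreal \<bar>f x\<bar>) \<and> L2_norm muX (\<lambda>x. ennreal \<bar>f x\<bar>) < \<infinity> \<and>
            ((\<lambda>s::real. ennreal (s\<^sup>2) * (\<integral>\<^sup>+x. (frac_integral muX rhoX s f x)\<^sup>2 \<partial>muX))
               \<longlongrightarrow> 0) (at_right 0))
       \<and> \<not> (\<exists>(C::real) (C'::real). 0 < C \<and> 0 < C' \<and>
            (\<forall>f \<in> L2_mod_const muX \<inter> (\<Union>s\<in>{0<..<1}. frac_Sobolev muX rhoX s).
               ennreal C * L2_mod_const_norm muX f
                 \<le> Liminf (at_right 0) (\<lambda>s::real. ennreal s * L2_norm muX (frac_integral muX rhoX s f)) \<and>
               Liminf (at_right 0) (\<lambda>s::real. ennreal s * L2_norm muX (frac_integral muX rhoX s f))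
                 \<le> Limsup (at_right 0) (\<lambda>s::real. ennreal s * L2_norm muX (frac_integral muX rhoX s f)) \<and>
               Limsup (at_right 0) (\<lambda>s::real. ennreal s * L2_norm muX (frac_integral muX rhoX s f))
                 \<le> ennreal C' * L2_mod_const_norm muX f))"
proof (intro conjI notI)
  have half: "bump \<in> (\<Union>s\<in>{0<..<1}. frac_Sobolev muX rhoX s)"
    using bump_in_frac_Sobolev[of "1 / 2"] by force
  have "0 < L2_norm muX (\<lambda>x. ennreal \<bar>bump x\<bar>)"
    using L2_norm_bump_plus_const_ge_1[of 0] less_le_trans[of 0 "1::ennreal"] by simp
  then show "\<exists>f \<in> L2_space muX \<inter> (\<Union>s\<in>{0<..<1}. frac_Sobolev muX rhoX s).
      0 < L2_norm muX (\<lambda>x. ennreal \<bar>f x\<bar>) \<and> L2_norm muX (\<lambda>x. ennreal \<bar>f x\<bar>) < \<infinity> \<and>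
      ((\<lambda>s::real. ennreal (s\<^sup>2) * (\<integral>\<^sup>+x. (frac_integral muX rhoX s f x)\<^sup>2 \<partial>muX))
         \<longlongrightarrow> 0) (at_right 0)"
    using half L2_norm_bump_finite bump_measurable frac_energy_bump_tendsto_0
    by (intro bexI[of _ bump]) (auto simp: L2_space_def)
  assume "\<exists>(C::real) (C'::real). 0 < C \<and> 0 < C' \<and>
            (\<forall>f \<in> L2_mod_const muX \<inter> (\<Union>s\<in>{0<..<1}. frac_Sobolev muX rhoX s).
               ennreal C * L2_mod_const_norm muX f
                 \<le> Liminf (at_right 0) (\<lambda>s::real. ennreal s * L2_norm muX (frac_integral muX rhoX s f)) \<and>
               Liminf (at_right 0) (\<lambda>s::real. ennreal s * L2_norm muX (frac_integral muX rhoX s f))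
                 \<le> Limsup (at_right 0) (\<lambda>s::real. ennreal s * L2_norm muX (frac_integral muX rhoX s f)) \<and>
               Limsup (at_right 0) (\<lambda>s::real. ennreal s * L2_norm muX (frac_integral muX rhoX s f))
                 \<le> ennreal C' * L2_mod_const_norm muX f)"
  then obtain C :: real where C: "0 < C"
    and le: "ennreal C * L2_mod_const_norm muX bump
      \<le> Liminf (at_right 0) (\<lambda>s::real. ennreal s * L2_norm muX (frac_integral muX rhoX s bump))"
    using half bump_in_L2_mod_const by blast
  have "ennreal C * 1 \<le> ennreal C * L2_mod_const_norm muX bump"
    by (intro mult_left_mono L2_mod_const_norm_bump_ge_1) simp
  also note le
  also have "Liminf (at_right 0) (\<lambda>s::real. ennreal s * L2_norm muX (frac_integral muX rhoX s bump)) = 0"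
    by (rule lim_imp_Liminf[OF _ frac_norm_bump_tendsto_0]) simp
  finally show False
    using C by simp
qed

end
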